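(* Let $\mathcal{K}(\mathbb{M}_2)\cong\mathbb{R}^6$ be the space of Killing $2$-tensors of the Minkowski plane with coordinates $(A,B,C,\alpha,\beta,\gamma)$, and let $G_M$, $R_0$, $S_1,S_3,S_4$ be as defined in the context. The set $(S_3\cap S_1)\setminus S_4$ has four connected components. The two pairs of components symmetric with respect to the origin (the components of each pair being mapped one onto the other by $R_0$) form two different orbits of the action of $G_M$.
   Context: In the Minkowski plane $\mathbb{M}_2$ with pseudo-Cartesian coordinates $(t,x)$ and metric $\mathbf{g}$ with contravariant components $\mathrm{diag}(1,-1)$, the general Killing $2$-tensor has contravariant components $K^{11}=A+2\alpha x+\gamma x^2$, $K^{12}=K^{21}=C+\alpha t+\beta x+\gamma tx$, $K^{22}=B+2\beta t+\gamma t^2$, with $A,B,C,\alpha,\beta,\gamma\in\mathbb{R}$. So the vector space $\mathcal{K}(\mathbb{M}_2)$ of Killing $2$-tensors is identified with $\mathbb{R}^6$ with coordinates $(A,B,C,\alpha,\beta,\gamma)$. With respect to $(\partial_A,\partial_B,\partial_C,\partial_\alpha,\partial_\beta,\partial_\gamma)$ define the vector fields on $\mathcal{K}(\mathbb{M}_2)$: $V_1=(0,-2\beta,-\alpha,0,-\gamma,0)$ and $V_2=(-2\alpha,0,-\beta,-\gamma,0,0)$ (translations); $V_3=(2C,2C,A+B,\beta,\alpha,0)$ (boost); $V_4=(2A,2B,2C,\alpha,\beta,0)$ (dilatation of the plane); $V_5=(1,-1,0,0,0,0)$ (addition of a multiple of the metric); $V_6=(A,B,C,\alpha,\beta,\gamma)$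 (scalar multiplication). Discrete transformations of $\mathcal{K}(\mathbb{M}_2)$ (unlisted coordinates are unchanged): $R_0:\mathbf{K}\mapsto-\mathbf{K}$; $R_1: C\mapsto-C,\ \alpha\mapsto-\alpha$; $R_2: C\mapsto-C,\ \beta\mapsto-\beta$. $G_M$ is the group of transformations of $\mathcal{K}(\mathbb{M}_2)$ generated by the flows of $V_1,\dots,V_6$ and by $R_0,R_1,R_2$. $S_1=\{\gamma=0\}$; $S_3=\{\gamma(A+B)=\alpha^2+\beta^2,\ \gamma C=\alpha\beta\}$; $S_4=\{\gamma=0,\ \alpha=\beta,\ A+B=2C\}\cup\{\gamma=0,\ \alpha=-\beta,\ A+B=-2C\}$. (Thus $S_3\cap S_1=\{\alpha=\beta=\gamma=0\}$.) *)

theory Defs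
  imports "HOL-Analysis.Analysis" "HOL-Algebra.Bij" "HOL-Algebra.Generated_Groups"
    "HOL-Algebra.Group_Action"
begin

(* The tuple (A, B, C, \<alpha>, \<beta>, \<gamma>) stands for the tensor field killing_tensor (A, B, C, \<alpha>, \<beta>, \<gamma>)
   below; the library topology and vector space structure on the product type are those of R^6. *)
type_synonym killing = "real \<times> real \<times> real \<times> real \<times> real \<times> real"

(* Contravariant components, at the point (t, x), of the general Killing 2-tensor of the Minkowski
   plane with metric diag(1, -1). *)
fun killing_tensor :: "killing \<Rightarrow> real \<times> real \<Rightarrow> real^2^2" where
  "killing_tensor (A, B, C, \<alpha>, \<beta>, \<gamma>) (t, x) =
     vector [vector [A + 2 * \<alpha> * x + \<gamma> * x\<^sup>2, C + \<alpha> * t + \<beta> * x + \<gamma> * t * x],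
             vector [C + \<alpha> * t + \<beta> * x + \<gamma> * t * x, B + 2 * \<beta> * t + \<gamma> * t\<^sup>2]]"

lemma inj_killing_tensor: "inj killing_tensor"
proof (rule injI)
  fix p q :: killing
  assume eq: "killing_tensor p = killing_tensor q"
  obtain A B C \<alpha> \<beta> \<gamma> where p: "p = (A, B, C, \<alpha>, \<beta>, \<gamma>)" by (cases p) auto
  obtain A' B' C' \<alpha>' \<beta>' \<gamma>' where q: "q = (A', B', C', \<alpha>', \<beta>', \<gamma>')" by (cases q) auto
  have comp: "killing_tensor p (t, x) $ i $ j = killing_tensor q (t, x) $ i $ j" for t x i j
    using eq by simp
  have "A = A'" "B = B'" "C = C'"
    using comp[of 0 0 1 1] comp[of 0 0 2 2] comp[of 0 0 1 2] by (simp_all add: p q)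
  moreover have "\<alpha> = \<alpha>'" "\<beta> = \<beta>'"
    using comp[of 1 0 1 2] comp[of 0 1 1 2] calculation by (simp_all add: p q)
  moreover have "\<gamma> = \<gamma>'"
    using comp[of 0 1 1 1] calculation by (simp add: p q)
  ultimately show "p = q" by (simp add: p q)
qed

fun V1 :: "killing \<Rightarrow> killing" where
  "V1 (A, B, C, \<alpha>, \<beta>, \<gamma>) = (0, - 2 * \<beta>, - \<alpha>, 0, - \<gamma>, 0)"

fun V2 :: "killing \<Rightarrow> killing" where
  "V2 (A, B, C, \<alpha>, \<beta>, \<gamma>) = (- 2 * \<alpha>, 0, - \<beta>, - \<gamma>, 0, 0)"

fun V3 :: "killing \<Rightarrow> killing" where
  "V3 (A, B, C, \<alpha>, \<beta>, \<gamma>) = (2 * C, 2 * C, A + B, \<beta>, \<alpha>, 0)"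

fun V4 :: "killing \<Rightarrow> killing" where
  "V4 (A, B, C, \<alpha>, \<beta>, \<gamma>) = (2 * A, 2 * B, 2 * C, \<alpha>, \<beta>, 0)"

fun V5 :: "killing \<Rightarrow> killing" where
  "V5 (A, B, C, \<alpha>, \<beta>, \<gamma>) = (1, - 1, 0, 0, 0, 0)"

fun V6 :: "killing \<Rightarrow> killing" where
  "V6 (A, B, C, \<alpha>, \<beta>, \<gamma>) = (A, B, C, \<alpha>, \<beta>, \<gamma>)"

definition R0 :: "killing \<Rightarrow> killing" where
  "R0 K = - K"

fun R1 :: "killing \<Rightarrow> killing" where
  "R1 (A, B, C, \<alpha>, \<beta>, \<gamma>) = (A, B, - C, - \<alpha>, \<beta>, \<gamma>)"

fun R2 :: "killing \<Rightarrow> killing" where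
  "R2 (A, B, C, \<alpha>, \<beta>, \<gamma>) = (A, B, - C, \<alpha>, - \<beta>, \<gamma>)"

(* \<Phi> is a global flow of V: s \<mapsto> \<Phi> s p is an integral curve through p, defined for all times.
   V1, ..., V6 are affine vector fields, so each of them has exactly one such \<Phi>. *)
definition is_flow :: "('a::real_normed_vector \<Rightarrow> 'a) \<Rightarrow> (real \<Rightarrow> 'a \<Rightarrow> 'a) \<Rightarrow> bool" where
  "is_flow V \<Phi> \<longleftrightarrow>
     (\<forall>p. \<Phi> 0 p = p \<and> (\<forall>s. ((\<lambda>u. \<Phi> u p) has_vector_derivative V (\<Phi> s p)) (at s)))"

definition G_M_generators :: "(killing \<Rightarrow> killing) set" where
  "G_M_generators =
     {\<Phi> s | V \<Phi> s. V \<in> {V1, V2, V3, V4, V5, V6} \<and> is_flow V \<Phi>} \<union> {R0, R1, R2}"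

(* subgroup_generated discards generators outside the carrier; here all generators are bijections
   of the whole space, so none is lost. *)
definition G_M :: "(killing \<Rightarrow> killing) monoid" where
  "G_M = subgroup_generated (BijGroup UNIV) G_M_generators"

definition G_M_orbits :: "killing set set" where
  "G_M_orbits = orbits G_M UNIV (\<lambda>g. g)"

definition S1 :: "killing set" where
  "S1 = {(A, B, C, \<alpha>, \<beta>, \<gamma>). \<gamma> = 0}"

definition S3 :: "killing set" where
  "S3 = {(A, B, C, \<alpha>, \<beta>, \<gamma>). \<gamma> * (A + B) = \<alpha>\<^sup>2 + \<beta>\<^sup>2 \<and> \<gamma> * C = \<alpha> * \<beta>}"

definition S4 :: "killing set" where
  "S4 = {(A, B, C, \<alpha>, \<beta>, \<gamma>). \<gamma> = 0 \<and> \<alpha> = \<beta> \<and> A + B = 2 * C} \<union>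
        {(A, B, C, \<alpha>, \<beta>, \<gamma>). \<gamma> = 0 \<and> \<alpha> = - \<beta> \<and> A + B = - 2 * C}"

end

theory Submission
  imports Defs
begin

text \<open>
  The condition \<open>\<alpha> = \<beta> = \<gamma> = 0\<close> that describes \<^term>\<open>S3 \<inter> S1\<close> singles out the tensor
  fields with constant components. On these, removing \<^term>\<open>S4\<close> means requiring that the two
  linear functionals \<open>A + B \<plusminus> 2 C\<close>, the values on the null covectors
  \<open>dt \<plusminus> dx\<close> of the quadratic form given by the tensor, do not vanish. Their signs cut the three-dimensional space of constant tensors
  into four convex open pieces, which are therefore the components, and \<^term>\<open>R0\<close> reverses
  both signs.

  The sign of the product of the two functionals is invariant under the group: translations fix a
  constant tensor, adding a multiple of the metric does not change the two functionals because the
  metric vanishes on null covectors, the boosts, dilatations and scalar multiplications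
  rescale them by positive factors, the reflections \<^term>\<open>R1\<close> and \<^term>\<open>R2\<close>
  exchange them, and \<^term>\<open>R0\<close> reverses both signs. So there are at least two orbits.
  Conversely, boosts and dilatations together rescale the two functionals by two arbitrary positive
  factors, adding a multiple of the metric adjusts the remaining coordinate \<open>A - B\<close> freely,
  and \<^term>\<open>R0\<close> connects opposite pieces; so two opposite pieces form one orbit.

  The flows are only given as families of integral curves. That these respect the sign follows
  without solving the systems in full: along any integral curve suitable linear functionals satisfy
  scalar equations \<open>f' = k f\<close>, where those for \<open>\<alpha> \<plusminus> \<beta>\<close> use that
  \<open>\<gamma>\<close> has been shown to vanish, and those for \<open>A + B \<plusminus> 2 C\<close> use that
  \<open>\<alpha>\<close>, \<open>\<beta>\<close> and \<open>\<gamma>\<close> have.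
\<close>

section \<open>Components of a set cut into relatively open pieces\<close>

text \<open>The complement of a piece is the union of the others, so every piece is both open and closed.\<close>

lemma components_eq_open_partition:
  assumes cover: "\<Union>F = S"
    and disj: "pairwise disjnt F"
    and opn: "\<And>U. U \<in> F \<Longrightarrow> openin (top_of_set S) U"
    and con: "\<And>U. U \<in> F \<Longrightarrow> connected U"
    and ne: "\<And>U. U \<in> F \<Longrightarrow> U \<noteq> {}"
  shows "components S = F"
proof -
  have comp: "U \<in> components S" if U: "U \<in> F" for U
    unfolding in_components_maximal
  proof (intro conjI allI impI)
    have "S - U = \<Union>(F - {U})"
      using cover disj U by (auto simp: pairwise_def disjnt_def)
    moreover have "openin (top_of_set S) (\<Union>(F - {U}))"
      using opn by (intro openin_Union) auto
    ultimately have "closedin (top_of_set S) U"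
      using U cover by (auto simp: closedin_def)
    fix D assume D: "D \<noteq> {} \<and> U \<subseteq> D \<and> D \<subseteq> S \<and> connected D"
    have "openin (top_of_set D) U" "closedin (top_of_set D) U"
      using D opn[OF U] \<open>closedin (top_of_set S) U\<close>
      by (meson openin_subset_trans closedin_subset_trans)+
    then show "D = U"
      using D ne[OF U] by (metis connected_clopen)
  qed (use U cover con ne in auto)
  show ?thesis
  proof
    show "components S \<subseteq> F"
    proof
      fix C assume C: "C \<in> components S"
      then obtain x where "x \<in> C" "x \<in> S"
        using in_components_nonempty in_components_subset by blast
      then obtain U where "U \<in> F" "x \<in> U"
        using cover by blast
      then show "C \<in> F"
        using comp C \<open>x \<in> C\<close> components_eq by (metis disjoint_iff)
    qed
  qed (use comp in auto)
qed

section \<open>Constant Killing tensors and their values on the null covectors\<close>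

fun gamma :: "killing \<Rightarrow> real" where "gamma (A, B, C, \<alpha>, \<beta>, \<gamma>) = \<gamma>"

text \<open>The sum and the difference of \<open>\<alpha>\<close> and \<open>\<beta>\<close> are used in place of \<open>\<alpha>\<close> and
  \<open>\<beta>\<close> because they diagonalise the boost.\<close>

fun alpha_plus_beta :: "killing \<Rightarrow> real" where
  "alpha_plus_beta (A, B, C, \<alpha>, \<beta>, \<gamma>) = \<alpha> + \<beta>"

fun alpha_minus_beta :: "killing \<Rightarrow> real" where
  "alpha_minus_beta (A, B, C, \<alpha>, \<beta>, \<gamma>) = \<alpha> - \<beta>"

text \<open>For a constant tensor these are the values of its quadratic form on \<open>dt + dx\<close> and
  \<open>dt - dx\<close>.\<close>

fun null_plus :: "killing \<Rightarrow> real" where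
  "null_plus (A, B, C, \<alpha>, \<beta>, \<gamma>) = A + B + 2 * C"

fun null_minus :: "killing \<Rightarrow> real" where
  "null_minus (A, B, C, \<alpha>, \<beta>, \<gamma>) = A + B - 2 * C"

lemma linear_functionals:
  "linear gamma" "linear alpha_plus_beta" "linear alpha_minus_beta" "linear null_plus"
  "linear null_minus"
  by (auto intro!: linearI simp: algebra_simps)

definition constant_tensors :: "killing set" where
  "constant_tensors = {K. gamma K = 0 \<and> alpha_plus_beta K = 0 \<and> alpha_minus_beta K = 0}"

lemma constant_tensors_iff:
  "(A, B, C, \<alpha>, \<beta>, \<gamma>) \<in> constant_tensors \<longleftrightarrow> \<alpha> = 0 \<and> \<beta> = 0 \<and> \<gamma> = 0"
  by (auto simp: constant_tensors_def)

text \<open>Only the signs of \<open>a\<close> and \<open>b\<close> matter. Writing a sign condition as a product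
  lets \<^term>\<open>R0\<close> act as negation of both parameters.\<close>

definition quadrant :: "real \<Rightarrow> real \<Rightarrow> killing set" where
  "quadrant a b = {K \<in> constant_tensors. 0 < a * null_plus K \<and> 0 < b * null_minus K}"

lemma S3_S1_minus_S4:
  "(S3 \<inter> S1) - S4 = {K \<in> constant_tensors. null_plus K \<noteq> 0 \<and> null_minus K \<noteq> 0}"
proof -
  have "K \<in> (S3 \<inter> S1) - S4 \<longleftrightarrow>
      K \<in> constant_tensors \<and> null_plus K \<noteq> 0 \<and> null_minus K \<noteq> 0" for K
    by (cases K) (auto simp: S1_def S3_def S4_def constant_tensors_iff sum_power2_eq_zero_iff)
  then show ?thesis by blast
qed

lemma connected_quadrant: "connected (quadrant a b)"
proof -
  have "quadrant a b = gamma -` {0} \<inter> alpha_plus_beta -` {0} \<inter> alpha_minus_beta -` {0} \<inter>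
      (\<lambda>K. a * null_plus K) -` {0<..} \<inter> (\<lambda>K. b * null_minus K) -` {0<..}"
    by (auto simp: quadrant_def constant_tensors_def)
  moreover have "linear (\<lambda>K. a * null_plus K)" "linear (\<lambda>K. b * null_minus K)"
    using linear_functionals by (auto intro: linear_compose_scale_right[where 'b = real, simplified])
  ultimately have "convex (quadrant a b)"
    using linear_functionals by (auto intro!: convex_Int convex_linear_vimage)
  then show ?thesis by (rule convex_connected)
qed

lemma quadrant_nonempty:
  assumes "a \<noteq> 0" "b \<noteq> 0"
  shows "quadrant a b \<noteq> {}"
proof -
  have "0 < a * a" "0 < b * b"
    using assms not_real_square_gt_zero by blast+
  moreover have "null_plus ((a + b) / 2, 0, (a - b) / 4, 0, 0, 0) = a"
    "null_minus ((a + b) / 2, 0, (a - b) / 4, 0, 0, 0) = b"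
    by (simp_all add: field_simps)
  ultimately have "((a + b) / 2, 0, (a - b) / 4, 0, 0, 0) \<in> quadrant a b"
    by (simp add: quadrant_def constant_tensors_iff del: null_plus.simps null_minus.simps)
  then show ?thesis by blast
qed

lemma openin_quadrant: "openin (top_of_set (S3 \<inter> S1 - S4)) (quadrant a b)"
proof -
  have "continuous_on UNIV null_plus" "continuous_on UNIV null_minus"
    using linear_functionals by (auto intro: linear_continuous_on simp: linear_conv_bounded_linear)
  then have "open {K. 0 < a * null_plus K}" "open {K. 0 < b * null_minus K}"
    by (auto intro!: open_Collect_less continuous_intros)
  then have "open ({K. 0 < a * null_plus K} \<inter> {K. 0 < b * null_minus K})"
    by blast
  moreover have "quadrant a b =
      (S3 \<inter> S1 - S4) \<inter> ({K. 0 < a * null_plus K} \<inter> {K. 0 < b * null_minus K})"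
    by (auto simp: quadrant_def S3_S1_minus_S4)
  ultimately show ?thesis
    by (metis openin_open_Int)
qed

lemma R0_image_quadrant: "R0 ` quadrant a b = quadrant (- a) (- b)"
proof -
  have "K \<in> quadrant a b \<longleftrightarrow> R0 K \<in> quadrant (- a) (- b)" for K
    using linear_functionals[THEN linear_neg] by (auto simp: quadrant_def constant_tensors_def R0_def)
  moreover have "R0 (R0 K) = K" for K
    by (simp add: R0_def)
  ultimately show ?thesis
    unfolding set_eq_iff image_iff by metis
qed

lemma pairwise_disjnt_quadrants:
  "pairwise disjnt {quadrant 1 1, quadrant (-1) (-1), quadrant 1 (-1), quadrant (-1) 1}"
  by (auto simp: pairwise_def disjnt_def quadrant_def)

lemma components_quadrants:
  "components ((S3 \<inter> S1) - S4) =
    {quadrant 1 1, quadrant (-1) (-1), quadrant 1 (-1), quadrant (-1) 1}"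
proof (rule components_eq_open_partition[OF _ pairwise_disjnt_quadrants])
  show "\<Union>{quadrant 1 1, quadrant (-1) (-1), quadrant 1 (-1), quadrant (-1) 1} =
      (S3 \<inter> S1) - S4"
    unfolding S3_S1_minus_S4 by (auto simp: quadrant_def not_less)
  fix U
  assume "U \<in> {quadrant 1 1, quadrant (-1) (-1), quadrant 1 (-1), quadrant (-1) 1}"
  then obtain a b where U: "U = quadrant a b" and "a \<noteq> 0" "b \<noteq> 0"
    by fastforce
  then show "openin (top_of_set ((S3 \<inter> S1) - S4)) U" "connected U" "U \<noteq> {}"
    using openin_quadrant connected_quadrant quadrant_nonempty by simp_all
qed

lemma card_quadrants:
  "card {quadrant 1 1, quadrant (-1) (-1), quadrant 1 (-1), quadrant (-1) 1} = 4"
proof -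
  have "quadrant a b \<noteq> quadrant c d"
    if "\<bar>a\<bar> = 1" "\<bar>b\<bar> = 1" "\<bar>c\<bar> = 1" "\<bar>d\<bar> = 1" "(a, b) \<noteq> (c, d)" for a b c d
  proof -
    have "quadrant a b \<inter> quadrant c d = {}"
      using that by (auto simp: quadrant_def abs_if split: if_splits)
    moreover have "a \<noteq> 0" "b \<noteq> 0"
      using that by auto
    ultimately show ?thesis
      using quadrant_nonempty by blast
  qed
  then show ?thesis
    by (simp add: card_insert_if)
qed

section \<open>Invariance of the sign\<close>

definition null_product_sign :: "real \<Rightarrow> killing set" where
  "null_product_sign e = {K \<in> constant_tensors. 0 < e * (null_plus K * null_minus K)}"

lemma quadrant_Un_R0_image:
  "quadrant a b \<union> R0 ` quadrant a b = null_product_sign (a * b)"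
proof -
  have "0 < a * b * (p * m) \<longleftrightarrow>
      0 < a * p \<and> 0 < b * m \<or> 0 < (- a) * p \<and> 0 < (- b) * m" for p m :: real
  proof -
    have "a * b * (p * m) = (a * p) * (b * m)"
      by (simp add: ac_simps)
    then show ?thesis
      by (simp only: zero_less_mult_iff[of "a * p"] mult_minus_left neg_0_less_iff_less)
  qed
  then show ?thesis
    unfolding R0_image_quadrant unfolding quadrant_def null_product_sign_def by blast
qed

lemma exponential_growth:
  fixes f :: "real \<Rightarrow> real"
  assumes "\<And>s. (f has_real_derivative k * f s) (at s)"
  shows "f t = f s * exp (k * (t - s))"
proof -
  have "((\<lambda>s. f s * exp (- k * s)) has_real_derivative 0) (at s)" for s
    by (rule derivative_eq_intros assms refl | simp add: algebra_simps)+
  then have "f t * exp (- k * t) = f s * exp (- k * s)"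
    by (intro DERIV_isconst_all) blast
  then have "f t * exp (- k * t) * exp (k * t) = f s * exp (- k * s) * exp (k * t)"
    by simp
  then show ?thesis
    by (simp add: mult.assoc exp_add[symmetric] algebra_simps)
qed

text \<open>The eigenvalue equation is required on the curve only, not on the whole space: some
  functionals satisfy it only on a subspace in which the curve has already been shown to stay.\<close>

lemma functional_along_curve:
  fixes f :: "killing \<Rightarrow> real"
  assumes curve: "\<And>s. (c has_vector_derivative V (c s)) (at s)"
    and "linear f"
    and eigen: "\<And>s. f (V (c s)) = k * f (c s)"
  shows "f (c t) = f (c s) * exp (k * (t - s))"
proof (rule exponential_growth)
  fix s
  have "bounded_linear f"
    using \<open>linear f\<close> by (simp add: linear_conv_bounded_linear)
  then have "((\<lambda>s. f (c s)) has_vector_derivative f (V (c s))) (at s)"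
    using curve by (rule bounded_linear.has_vector_derivative)
  then show "((\<lambda>s. f (c s)) has_real_derivative k * f (c s)) (at s)"
    by (simp add: eigen has_real_derivative_iff_has_vector_derivative)
qed

text \<open>Each functional is an eigenfunctional of each generating field, modulo the functionals
  treated before it. The boost has opposite eigenvalues on the two null directions.\<close>

lemma generating_fields_triangular:
  assumes "V \<in> {V1, V2, V3, V4, V5, V6}"
  obtains kg kp km lp lm where
    "\<And>K. gamma (V K) = kg * gamma K"
    "\<And>K. gamma K = 0 \<Longrightarrow> alpha_plus_beta (V K) = kp * alpha_plus_beta K"
    "\<And>K. gamma K = 0 \<Longrightarrow> alpha_minus_beta (V K) = km * alpha_minus_beta K"
    "\<And>K. K \<in> constant_tensors \<Longrightarrow> null_plus (V K) = lp * null_plus K"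
    "\<And>K. K \<in> constant_tensors \<Longrightarrow> null_minus (V K) = lm * null_minus K"
proof -
  define good where "good V kg kp km lp lm \<longleftrightarrow> (\<forall>K.
    gamma (V K) = kg * gamma K \<and>
    (gamma K = 0 \<longrightarrow> alpha_plus_beta (V K) = kp * alpha_plus_beta K) \<and>
    (gamma K = 0 \<longrightarrow> alpha_minus_beta (V K) = km * alpha_minus_beta K) \<and>
    (K \<in> constant_tensors \<longrightarrow> null_plus (V K) = lp * null_plus K) \<and>
    (K \<in> constant_tensors \<longrightarrow> null_minus (V K) = lm * null_minus K))"
    for V :: "killing \<Rightarrow> killing" and kg kp km lp lm
  have fields: "good V1 0 0 0 0 0" "good V2 0 0 0 0 0" "good V3 0 1 (-1) 2 (-2)"
    "good V4 0 1 1 2 2" "good V5 0 0 0 0 0" "good V6 1 1 1 1 1"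
    by (auto simp: good_def constant_tensors_iff algebra_simps)
  have "\<exists>kg kp km lp lm. good V kg kp km lp lm"
    using assms by safe (use fields in blast)+
  then show ?thesis
    unfolding good_def using that by metis
qed

text \<open>A curve that starts among the constant tensors is first shown to stay there; only then are
  the null values known to evolve by positive factors.\<close>

lemma integral_curve_null_product_sign:
  assumes V: "V \<in> {V1, V2, V3, V4, V5, V6}"
    and curve: "\<And>s. (c has_vector_derivative V (c s)) (at s)"
    and start: "c s \<in> null_product_sign e"
  shows "c t \<in> null_product_sign e"
proof -
  obtain kg kp km lp lm where fields:
    "\<And>K. gamma (V K) = kg * gamma K"
    "\<And>K. gamma K = 0 \<Longrightarrow> alpha_plus_beta (V K) = kp * alpha_plus_beta K"
    "\<And>K. gamma K = 0 \<Longrightarrow> alpha_minus_beta (V K) = km * alpha_minus_beta K"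
    "\<And>K. K \<in> constant_tensors \<Longrightarrow> null_plus (V K) = lp * null_plus K"
    "\<And>K. K \<in> constant_tensors \<Longrightarrow> null_minus (V K) = lm * null_minus K"
    using generating_fields_triangular[OF V] by metis
  note along = functional_along_curve[OF curve]
  have s: "c s \<in> constant_tensors"
    using start by (simp add: null_product_sign_def)
  have gamma: "gamma (c t) = 0" for t
    using along[OF linear_functionals(1) fields(1), of t s] s by (simp add: constant_tensors_def)
  have "alpha_plus_beta (c t) = 0" "alpha_minus_beta (c t) = 0" for t
    using along[OF linear_functionals(2) fields(2)[OF gamma], of t s]
      along[OF linear_functionals(3) fields(3)[OF gamma], of t s] s
    by (simp_all add: constant_tensors_def)
  with gamma have const: "c t \<in> constant_tensors" for t
    by (simp add: constant_tensors_def)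
  have "null_plus (c t) = null_plus (c s) * exp (lp * (t - s))"
    "null_minus (c t) = null_minus (c s) * exp (lm * (t - s))"
    using along[OF linear_functionals(4) fields(4)[OF const]]
      along[OF linear_functionals(5) fields(5)[OF const]] by blast+
  then have "e * (null_plus (c t) * null_minus (c t)) =
      e * (null_plus (c s) * null_minus (c s)) * (exp (lp * (t - s)) * exp (lm * (t - s)))"
    by simp
  moreover have "0 < e * (null_plus (c s) * null_minus (c s))"
    using start by (simp add: null_product_sign_def)
  ultimately have "0 < e * (null_plus (c t) * null_minus (c t))"
    by (metis exp_gt_zero mult_pos_pos)
  with const show ?thesis
    by (simp add: null_product_sign_def)
qed

text \<open>For a flow, both implications hold because an integral curve can be followed backwards as
  well as forwards; this form passes to inverses in the group.\<close>

lemma generator_null_product_sign: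
  assumes "h \<in> G_M_generators"
  shows "h p \<in> null_product_sign e \<longleftrightarrow> p \<in> null_product_sign e"
proof -
  consider (flow) V \<Phi> s where "V \<in> {V1, V2, V3, V4, V5, V6}" "is_flow V \<Phi>" "h = \<Phi> s"
    | (discrete) "h \<in> {R0, R1, R2}"
    using assms by (auto simp: G_M_generators_def)
  then show ?thesis
  proof cases
    case flow
    then have "\<Phi> 0 p = p" "\<And>s. ((\<lambda>u. \<Phi> u p) has_vector_derivative V (\<Phi> s p)) (at s)"
      unfolding is_flow_def by blast+
    then show ?thesis
      using integral_curve_null_product_sign[where c = "\<lambda>u. \<Phi> u p"] flow by metis
  next
    case discrete
    obtain A B C \<alpha> \<beta> \<gamma> where p: "p = (A, B, C, \<alpha>, \<beta>, \<gamma>)"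
      by (cases p)
    from discrete show ?thesis
      by (auto simp: p null_product_sign_def constant_tensors_iff R0_def algebra_simps)
  qed
qed

lemma carrier_BijGroup: "carrier (BijGroup S) = Bij S"
  by (simp add: BijGroup_def)

lemma one_BijGroup_UNIV: "\<one>\<^bsub>BijGroup UNIV\<^esub> = (\<lambda>x. x)"
  by (simp add: BijGroup_def restrict_def)

lemma mult_BijGroup_UNIV:
  "g \<in> Bij UNIV \<Longrightarrow> h \<in> Bij UNIV \<Longrightarrow> g \<otimes>\<^bsub>BijGroup UNIV\<^esub> h = (\<lambda>x. g (h x))"
  by (simp add: BijGroup_def compose_def restrict_def)

lemma carrier_G_M: "carrier G_M = generate (BijGroup UNIV) (Bij UNIV \<inter> G_M_generators)"
  by (simp add: G_M_def carrier_subgroup_generated carrier_BijGroup)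

lemma carrier_G_M_subset: "carrier G_M \<subseteq> Bij UNIV"
  using group.generate_incl[OF group_BijGroup, of "Bij UNIV \<inter> G_M_generators"]
  by (auto simp: carrier_G_M carrier_BijGroup)

lemma G_M_invariant_set:
  assumes "g \<in> carrier G_M"
    and gen: "\<And>h p. h \<in> G_M_generators \<Longrightarrow> h p \<in> X \<longleftrightarrow> p \<in> X"
  shows "g p \<in> X \<longleftrightarrow> p \<in> X"
  using assms(1) unfolding carrier_G_M
proof (induction arbitrary: p rule: generate.induct)
  case one
  then show ?case by (simp add: one_BijGroup_UNIV)
next
  case (incl h)
  then show ?case using gen by blast
next
  case (inv h)
  then have h: "h \<in> carrier (BijGroup UNIV)" "h \<in> Bij UNIV" "h \<in> G_M_generators"
    by (auto simp: carrier_BijGroup)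
  have "inv\<^bsub>BijGroup UNIV\<^esub> h \<in> Bij UNIV"
    using group.inv_closed[OF group_BijGroup h(1)] by (simp only: carrier_BijGroup)
  then have "h ((inv\<^bsub>BijGroup UNIV\<^esub> h) p) = p"
    using group.r_inv[OF group_BijGroup h(1)] mult_BijGroup_UNIV[OF h(2)]
    by (simp only: one_BijGroup_UNIV fun_eq_iff)
  then show ?case using gen h by metis
next
  case (eng h1 h2)
  then have "h1 \<in> Bij UNIV" "h2 \<in> Bij UNIV"
    using carrier_G_M_subset by (auto simp: carrier_G_M)
  then show ?case
    using eng.IH by (simp add: mult_BijGroup_UNIV)
qed

section \<open>Transitivity\<close>

lemma G_M_comp:
  assumes "g \<in> carrier G_M" "h \<in> carrier G_M"
  shows "(\<lambda>p. g (h p)) \<in> carrier G_M"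
proof -
  have "g \<otimes>\<^bsub>BijGroup UNIV\<^esub> h = (\<lambda>p. g (h p))"
    using assms carrier_G_M_subset by (intro mult_BijGroup_UNIV) auto
  then show ?thesis
    using assms generate.eng[of g "BijGroup UNIV" _ h] by (simp add: carrier_G_M)
qed

text \<open>The group is generated by those generators that are bijections, so bijectivity has to be
  checked before a generator can be used.\<close>

lemma bij_generator_in_G_M: "h \<in> G_M_generators \<Longrightarrow> bij h \<Longrightarrow> h \<in> carrier G_M"
  by (auto simp: carrier_G_M Bij_def extensional_def intro: generate.incl)

lemma flow_in_G_M:
  assumes "V \<in> {V1, V2, V3, V4, V5, V6}" "is_flow V \<Phi>"
    and "\<And>s p. \<Phi> s (\<Phi> (- s) p) = p"
  shows "\<Phi> s \<in> carrier G_M"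
proof (rule bij_generator_in_G_M)
  show "\<Phi> s \<in> G_M_generators"
    using assms(1,2) unfolding G_M_generators_def by blast
  show "bij (\<Phi> s)"
    using assms(3)[of s] assms(3)[of "- s"]
    by (intro bij_betw_byWitness[where f' = "\<Phi> (- s)"]) auto
qed

lemma R0_in_G_M: "R0 \<in> carrier G_M"
proof (rule bij_generator_in_G_M)
  show "bij R0"
    by (rule bij_betw_byWitness[where f' = R0]) (auto simp: R0_def)
qed (auto simp: G_M_generators_def)

text \<open>The solution is the hyperbolic rotation of \<open>(\<alpha>, \<beta>)\<close> by \<open>s\<close> and of
  \<open>((A + B) / 2, C)\<close> by \<open>2 s\<close>, with \<open>A - B\<close> and \<open>\<gamma>\<close> fixed.\<close>

fun boost :: "real \<Rightarrow> killing \<Rightarrow> killing" where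
  "boost s (A, B, C, \<alpha>, \<beta>, \<gamma>) =
    ((A - B) / 2 + (A + B) / 2 * cosh (2 * s) + C * sinh (2 * s),
     (B - A) / 2 + (A + B) / 2 * cosh (2 * s) + C * sinh (2 * s),
     C * cosh (2 * s) + (A + B) / 2 * sinh (2 * s),
     \<alpha> * cosh s + \<beta> * sinh s, \<alpha> * sinh s + \<beta> * cosh s, \<gamma>)"

fun dilatation :: "real \<Rightarrow> killing \<Rightarrow> killing" where
  "dilatation s (A, B, C, \<alpha>, \<beta>, \<gamma>) =
    (A * exp (2 * s), B * exp (2 * s), C * exp (2 * s), \<alpha> * exp s, \<beta> * exp s, \<gamma>)"

fun metric_shift :: "real \<Rightarrow> killing \<Rightarrow> killing" where
  "metric_shift s (A, B, C, \<alpha>, \<beta>, \<gamma>) = (A + s, B - s, C, \<alpha>, \<beta>, \<gamma>)"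

lemma is_flow_boost: "is_flow V3 boost"
  unfolding is_flow_def
proof (intro allI conjI)
  fix p :: killing and s
  obtain A B C \<alpha> \<beta> \<gamma> where p: "p = (A, B, C, \<alpha>, \<beta>, \<gamma>)"
    by (cases p)
  show "boost 0 p = p"
    by (simp add: p field_simps)
  show "((\<lambda>u. boost u p) has_vector_derivative V3 (boost s p)) (at s)"
    unfolding p boost.simps V3.simps
    by (intro has_vector_derivative_Pair;
        simp only: has_real_derivative_iff_has_vector_derivative[symmetric])
      (rule derivative_eq_intros refl | simp add: field_simps)+
qed

lemma is_flow_dilatation: "is_flow V4 dilatation"
  unfolding is_flow_def
proof (intro allI conjI)
  fix p :: killing and s
  obtain A B C \<alpha> \<beta> \<gamma> where p: "p = (A, B, C, \<alpha>, \<beta>, \<gamma>)"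
    by (cases p)
  show "dilatation 0 p = p"
    by (simp add: p)
  show "((\<lambda>u. dilatation u p) has_vector_derivative V4 (dilatation s p)) (at s)"
    unfolding p dilatation.simps V4.simps
    by (intro has_vector_derivative_Pair;
        simp only: has_real_derivative_iff_has_vector_derivative[symmetric])
      (rule derivative_eq_intros refl | simp)+
qed

lemma is_flow_metric_shift: "is_flow V5 metric_shift"
  unfolding is_flow_def
proof (intro allI conjI)
  fix p :: killing and s
  obtain A B C \<alpha> \<beta> \<gamma> where p: "p = (A, B, C, \<alpha>, \<beta>, \<gamma>)"
    by (cases p)
  show "metric_shift 0 p = p"
    by (simp add: p)
  show "((\<lambda>u. metric_shift u p) has_vector_derivative V5 (metric_shift s p)) (at s)"
    unfolding p metric_shift.simps V5.simps
    by (intro has_vector_derivative_Pair;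
        simp only: has_real_derivative_iff_has_vector_derivative[symmetric])
      (rule derivative_eq_intros refl | simp)+
qed

lemma null_boost:
  "null_plus (boost s p) = null_plus p * exp (2 * s)"
  "null_minus (boost s p) = null_minus p * exp (- 2 * s)"
  by (cases p; simp add: cosh_def sinh_def field_simps)+

lemma boost_inverse: "boost s (boost (- s) p) = p"
proof -
  obtain A B C \<alpha> \<beta> \<gamma> where p: "p = (A, B, C, \<alpha>, \<beta>, \<gamma>)"
    by (cases p)
  have "cosh (2 * s) * cosh (2 * s) = 1 + sinh (2 * s) * sinh (2 * s)"
    "cosh s * cosh s = 1 + sinh s * sinh s"
    using cosh_square_eq[of "2 * s"] cosh_square_eq[of s] by (simp_all add: power2_eq_square)
  then show ?thesis
    by (simp add: p algebra_simps add_divide_distrib diff_divide_distrib)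
qed

lemma boost_in_G_M: "boost s \<in> carrier G_M"
  using is_flow_boost boost_inverse by (intro flow_in_G_M) auto

lemma dilatation_in_G_M: "dilatation s \<in> carrier G_M"
proof (rule flow_in_G_M[OF _ is_flow_dilatation])
  fix s p show "dilatation s (dilatation (- s) p) = p"
    by (cases p) (simp add: exp_minus)
qed simp

lemma metric_shift_in_G_M: "metric_shift s \<in> carrier G_M"
proof (rule flow_in_G_M[OF _ is_flow_metric_shift])
  fix s p show "metric_shift s (metric_shift (- s) p) = p"
    by (cases p) simp
qed simp

text \<open>The null values together with \<open>A - B\<close> are coordinates on the constant tensors, and the
  last one can be shifted freely.\<close>

lemma metric_shift_to:
  assumes "p \<in> constant_tensors" "q \<in> constant_tensors"
    and "null_plus q = null_plus p" "null_minus q = null_minus p"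
  shows "\<exists>s. metric_shift s p = q"
proof -
  obtain A B C \<alpha> \<beta> \<gamma> A' B' C' \<alpha>' \<beta>' \<gamma>' where
    pq: "p = (A, B, C, \<alpha>, \<beta>, \<gamma>)" "q = (A', B', C', \<alpha>', \<beta>', \<gamma>')"
    by (cases p; cases q)
  have "metric_shift (A' - A) p = q"
    using assms by (simp add: pq constant_tensors_iff)
  then show ?thesis ..
qed

lemma quadrant_transitive:
  assumes "p \<in> quadrant a b" "q \<in> quadrant a b"
  shows "\<exists>g \<in> carrier G_M. g p = q"
proof -
  define x where "x = null_plus q / null_plus p"
  define y where "y = null_minus q / null_minus p"
  have pos: "0 < x" "0 < y"
    and nz: "null_plus p \<noteq> 0" "null_minus p \<noteq> 0"
    using assms by (auto simp: quadrant_def x_def y_def zero_less_mult_iff zero_less_divide_iff)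
  \<comment> \<open>Boost by \<open>s\<close> and dilatation by \<open>r\<close> multiply the null values by
    \<open>exp (2 r \<plusminus> 2 s)\<close>, which have to be \<open>x\<close> and \<open>y\<close>.\<close>
  define r where "r = (ln x + ln y) / 4"
  define s where "s = (ln x - ln y) / 4"
  define m where "m = dilatation r (boost s p)"
  have dil: "null_plus (dilatation r k) = null_plus k * exp (2 * r)"
    "null_minus (dilatation r k) = null_minus k * exp (2 * r)" for k
    by (cases k; simp add: algebra_simps)+
  have "2 * s + 2 * r = ln x" "- 2 * s + 2 * r = ln y"
    by (simp_all add: r_def s_def field_simps)
  then have "exp (2 * s) * exp (2 * r) = x" "exp (- 2 * s) * exp (2 * r) = y"
    using pos by (simp_all only: exp_add[symmetric] exp_ln)
  then have "null_plus m = null_plus p * x" "null_minus m = null_minus p * y"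
    by (simp_all only: m_def dil null_boost mult.assoc)
  then have "null_plus m = null_plus q" "null_minus m = null_minus q"
    using nz by (simp_all add: x_def y_def)
  moreover have "m \<in> constant_tensors" "q \<in> constant_tensors"
    using assms by (cases p; auto simp: m_def quadrant_def constant_tensors_iff)+
  ultimately obtain t where "metric_shift t m = q"
    using metric_shift_to by metis
  moreover have "(\<lambda>p. metric_shift t (dilatation r (boost s p))) \<in> carrier G_M"
    using G_M_comp[OF metric_shift_in_G_M G_M_comp[OF dilatation_in_G_M boost_in_G_M]] .
  ultimately show ?thesis
    unfolding m_def by (rule bexI)
qed

lemma opposite_quadrants_transitive:
  assumes p: "p \<in> quadrant a b" and q: "q \<in> quadrant a b \<union> R0 ` quadrant a b"
  shows "\<exists>g \<in> carrier G_M. g p = q"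
proof (cases "q \<in> quadrant a b")
  case True
  then show ?thesis using quadrant_transitive p by blast
next
  case False
  then obtain q' where "q' \<in> quadrant a b" "q = R0 q'"
    using q by blast
  then obtain g where "g \<in> carrier G_M" "g p = q'"
    using quadrant_transitive p by blast
  then have "(\<lambda>p. R0 (g p)) \<in> carrier G_M" "R0 (g p) = q"
    using G_M_comp[OF R0_in_G_M] \<open>q = R0 q'\<close> by simp_all
  then show ?thesis
    by (intro bexI[of _ "\<lambda>p. R0 (g p)"])
qed

lemma opposite_quadrants_in_orbits:
  assumes "a \<noteq> 0" "b \<noteq> 0"
  shows "quadrant a b \<union> R0 ` quadrant a b \<in> G_M_orbits"
proof -
  obtain p where p: "p \<in> quadrant a b"
    using quadrant_nonempty assms by blast
  have "p \<in> quadrant a b \<union> R0 ` quadrant a b"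
    using p ..
  then have "g p \<in> quadrant a b \<union> R0 ` quadrant a b" if "g \<in> carrier G_M" for g
    unfolding quadrant_Un_R0_image
    using that by (simp add: G_M_invariant_set generator_null_product_sign)
  moreover have "\<exists>g \<in> carrier G_M. q = g p" if "q \<in> quadrant a b \<union> R0 ` quadrant a b" for q
    using opposite_quadrants_transitive[OF p that] by (simp only: eq_commute[of q])
  ultimately have "orbit G_M (\<lambda>g. g) p = quadrant a b \<union> R0 ` quadrant a b"
    unfolding orbit_def by blast
  then have "quadrant a b \<union> R0 ` quadrant a b = orbit G_M (\<lambda>g. g) p \<and> p \<in> UNIV"
    by simp
  then show ?thesis
    unfolding G_M_orbits_def orbits_def by (intro CollectI exI)
qed

theorem proposition26:
  shows "card (components ((S3 \<inter> S1) - S4)) = 4 \<and>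
    (\<exists>U W. components ((S3 \<inter> S1) - S4) = {U, R0 ` U, W, R0 ` W} \<and>
       U \<union> R0 ` U \<in> G_M_orbits \<and> W \<union> R0 ` W \<in> G_M_orbits \<and>
       U \<union> R0 ` U \<noteq> W \<union> R0 ` W)"
proof
  show "card (components ((S3 \<inter> S1) - S4)) = 4"
    by (simp only: components_quadrants card_quadrants)
  have "quadrant 1 1 \<inter> (quadrant 1 (-1) \<union> R0 ` quadrant 1 (-1)) = {}"
    unfolding R0_image_quadrant by (auto simp: quadrant_def)
  then have "quadrant 1 1 \<union> R0 ` quadrant 1 1 \<noteq> quadrant 1 (-1) \<union> R0 ` quadrant 1 (-1)"
    using quadrant_nonempty[of 1 1] by auto
  moreover have "components ((S3 \<inter> S1) - S4) =
      {quadrant 1 1, R0 ` quadrant 1 1, quadrant 1 (-1), R0 ` quadrant 1 (-1)}"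
    by (simp add: components_quadrants R0_image_quadrant)
  ultimately show "\<exists>U W. components ((S3 \<inter> S1) - S4) = {U, R0 ` U, W, R0 ` W} \<and>
       U \<union> R0 ` U \<in> G_M_orbits \<and> W \<union> R0 ` W \<in> G_M_orbits \<and>
       U \<union> R0 ` U \<noteq> W \<union> R0 ` W"
    using opposite_quadrants_in_orbits[of 1 1] opposite_quadrants_in_orbits[of 1 "-1"]
    by (intro exI[of _ "quadrant 1 1"] exI[of _ "quadrant 1 (-1)"]) simp
qed

end
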